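(* Let $d\geq 2$, $1\leq p_1,p_2<\infty$ and $0<p\le\infty$. Suppose there is a constant $C$ such that $$\|\mathcal{T}(f,g)\|_{L^p(\mathbb{R}^d)}\leq C\|f\|_{L^{p_1}(\mathbb{R}^d)}\|g\|_{L^{p_2}(\mathbb{R}^d)}$$ for all positive integers $d_1,d_2$ with $d=d_1+d_2$ and all functions $f\in L^{p_1}(\mathbb{R}^d)$, $g\in L^{p_2}(\mathbb{R}^d)$ of the product form $f(x)=f_1(x_1)f_2(x_2)$ and $g(x)=g_1(x_1)g_2(x_2)$, where $x=(x_1,x_2)$ with $x_1\in\mathbb{R}^{d_1}$, $x_2\in\mathbb{R}^{d_2}$. Then $$\frac{d+1}{p_1}+\frac{d+1}{p_2}\leq d-1+\frac{d+1}{p}.$$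
   Context: $\mathcal{T}$ is the bilinear operator $$\mathcal{T}(f,g)(x)=\int_{\mathbb{S}^{d-1}}f(x-y)\,g(x+y)\,d\sigma(y),\qquad x\in\mathbb{R}^d,$$ where $\sigma$ is the surface measure on the unit sphere $\mathbb{S}^{d-1}\subset\mathbb{R}^d$. *)

theory Defs
  imports "HOL-Analysis.Analysis" "HOL-Probability.Essential_Supremum"
begin

(* The (unnormalised) surface measure on the unit sphere, in the cone form
   sigma(A) = d * Lebesgue{x. 0 < |x| < 1, x/|x| in A}, i.e. the measure occurring in the
   polar-coordinates formula; see emeasure_sphere_measure below.  It is completed because T is
   applied to Lebesgue (not only Borel) measurable functions: for such f and g the integrand
   y |-> f(x - y) g(x + y) is, for almost every x, measurable for the completion only. *)
definition sphere_measure :: "'a::euclidean_space measure" where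
  "sphere_measure = completion
     (distr (scale_measure (of_nat DIM('a)) (restrict_space lborel (ball 0 1 - {0})))
            (restrict_space borel (sphere 0 1)) (\<lambda>x. x /\<^sub>R norm x))"

lemma space_sphere_measure [simp]: "space (sphere_measure :: 'a::euclidean_space measure) = sphere 0 1"
  by (simp add: sphere_measure_def space_restrict_space)

lemma emeasure_sphere_measure:
  fixes A :: "'a::euclidean_space set"
  assumes "A \<in> sets borel" "A \<subseteq> sphere 0 1"
  shows "emeasure sphere_measure A =
    of_nat DIM('a) * emeasure lborel {x \<in> ball 0 1 - {0}. x /\<^sub>R norm x \<in> A}"
proof -
  define R where "R = restrict_space lborel (ball 0 1 - {0 :: 'a})"
  define D where "D = distr (scale_measure (of_nat DIM('a)) R)
            (restrict_space borel (sphere 0 1)) (\<lambda>x::'a. x /\<^sub>R norm x)"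
  have m: "(\<lambda>x::'a. x /\<^sub>R norm x) \<in> scale_measure (of_nat DIM('a)) R
      \<rightarrow>\<^sub>M restrict_space borel (sphere 0 1)"
    unfolding R_def
    by (subst measurable_cong_sets[OF sets_scale_measure refl])
       (intro measurable_restrict_space2 measurable_restrict_space1;
        auto simp: space_restrict_space)
  have A: "A \<in> sets (restrict_space borel (sphere 0 1))"
    using assms by (auto simp: sets_restrict_space)
  have "emeasure sphere_measure A = emeasure D A"
    using A by (simp add: sphere_measure_def D_def R_def)
  also have "\<dots> = emeasure (scale_measure (of_nat DIM('a)) R)
      ((\<lambda>x. x /\<^sub>R norm x) -` A \<inter> space R)"
    unfolding D_def using m A by (subst emeasure_distr) (auto simp: space_scale_measure)
  also have "\<dots> = of_nat DIM('a) * emeasure R ((\<lambda>x. x /\<^sub>R norm x) -` A \<inter> space R)"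
    by simp
  also have "(\<lambda>x. x /\<^sub>R norm x) -` A \<inter> space R = {x \<in> ball 0 1 - {0}. x /\<^sub>R norm x \<in> A}"
    by (auto simp: R_def space_restrict_space)
  also have "emeasure R \<dots> = emeasure lborel \<dots>"
    unfolding R_def by (subst emeasure_restrict_space) auto
  finally show ?thesis .
qed

(* Points where the integrand is not integrable get the value 0 (Bochner convention). *)
definition bilinear_spherical ::
    "('a::euclidean_space \<Rightarrow> complex) \<Rightarrow> ('a \<Rightarrow> complex) \<Rightarrow> 'a \<Rightarrow> complex" where
  "bilinear_spherical f g x = (LINT y|sphere_measure. f (x - y) * g (x + y))"

(* The L^p (quasi-)norm, for 0 < p <= infinity, with values in [0, infinity].  The case
   distinction on I is needed because there is no power function on ennreal. *)
definition Lp_norm :: "'a measure \<Rightarrow> ereal \<Rightarrow> ('a \<Rightarrow> complex) \<Rightarrow> ennreal" where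
  "Lp_norm M p f =
     (if p = \<infinity> then esssup M (\<lambda>x. ennreal (norm (f x)))
      else let I = (\<integral>\<^sup>+ x. ennreal (norm (f x) powr real_of_ereal p) \<partial>M)
           in if I = \<infinity> then \<infinity> else ennreal (enn2real I powr (1 / real_of_ereal p)))"

definition Lp_space :: "'a measure \<Rightarrow> ereal \<Rightarrow> ('a \<Rightarrow> complex) set" where
  "Lp_space M p = {f \<in> borel_measurable M. Lp_norm M p f < \<infinity>}"

(* Given an enumeration e 0, ..., e (d-1) of the coordinates of R^d, the k consecutive
   coordinates of x starting with number m, as a point of R^k; a point of R^k is represented
   as an extensional function on {..<k}. *)
definition coord_block :: "(nat \<Rightarrow> 'n) \<Rightarrow> nat \<Rightarrow> nat \<Rightarrow> real ^ 'n \<Rightarrow> nat \<Rightarrow> real" where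
  "coord_block e m k x = (\<lambda>i\<in>{..<k}. x $ e (m + i))"

definition product_form ::
    "(nat \<Rightarrow> 'n) \<Rightarrow> nat \<Rightarrow> nat \<Rightarrow> (real ^ 'n \<Rightarrow> complex) \<Rightarrow> bool" where
  "product_form e d1 d2 f \<longleftrightarrow>
     (\<exists>f1 f2. \<forall>x. f x = f1 (coord_block e 0 d1 x) * f2 (coord_block e d1 d2 x))"

end

theory Submission
  imports Defs
begin

(* Knapp's example: let x_k be the last coordinate and let f and g be indicators of boxes centred
   at -e_k and e_k, of width about r in the directions other than x_k and about r^2 in the
   direction of x_k.  For x in a comparable box around 0 the cap of radius r around e_k
   contributes about r^(d-1) to T(f,g)(x), and boxes are product sets, so the assumed inequality
   for r -> 0 compares the exponents d - 1 + (d+1)/p and (d+1)/p1 + (d+1)/p2 of r. *)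

section \<open>L^p norms: a lower bound and the value on indicators\<close>

text \<open>Chebyshev's inequality, in a form that covers \<open>p = \<infinity>\<close>: there
  \<open>real_of_ereal (1 / p)\<close> is 0 and the factor \<open>V powr 0\<close> is 1. The
  function \<open>f\<close> is arbitrary, so the bound applies to T(f,g) without a proof of its
  measurability.\<close>

lemma Lp_norm_ge:
  assumes A: "A \<in> sets M" "emeasure M A = ennreal V" and V: "0 < V" and c: "0 < c"
    and f: "\<And>x. x \<in> A \<Longrightarrow> c \<le> norm (f x)" and p: "0 < p"
  shows "ennreal (c * V powr real_of_ereal (1 / p)) \<le> Lp_norm M p f"
proof (cases "p = \<infinity>")
  case True
  have "ennreal c \<le> esssup M (\<lambda>x. ennreal (norm (f x)))"
  proof (rule ccontr)
    assume less: "\<not> ?thesis"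
    then have meas: "(\<lambda>x. ennreal (norm (f x))) \<in> borel_measurable M"
      by (metis esssup_non_measurable top_greatest)
    have "AE x in M. ennreal (norm (f x)) \<le> esssup M (\<lambda>x. ennreal (norm (f x)))"
      by (rule esssup_AE)
    \<comment> \<open>A point of \<open>A\<close> satisfying the a.e. bound would give
      \<open>c\<close> at most the essential supremum, contrary to \<open>less\<close>; so
      \<open>A\<close> is a null set, against \<open>V > 0\<close>.\<close>
    then have "AE x in M. x \<notin> A"
    proof eventually_elim
      case (elim x)
      then show ?case
        using less f[of x] ennreal_leI[of c "norm (f x)"] by (meson order_trans)
    qed
    then have "emeasure M A = 0"
      using A sets.sets_into_space[OF A(1)] by (subst (asm) AE_iff_measurable[of A]) auto
    with A V show False by simp
  qed
  then show ?thesis using True V by (simp add: Lp_norm_def)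
next
  case False
  define q where "q = real_of_ereal p"
  have q: "0 < q" and pq: "p = ereal q"
    using p False by (cases p; auto simp: q_def)+
  define I where "I = (\<integral>\<^sup>+ x. ennreal (norm (f x) powr q) \<partial>M)"
  have "ennreal (c powr q * V) = (\<integral>\<^sup>+ x. ennreal (c powr q) * indicator A x \<partial>M)"
    using A V by (simp add: nn_integral_cmult_indicator ennreal_mult)
  also have "\<dots> \<le> I"
    unfolding I_def using f c q
    by (intro nn_integral_mono) (auto simp: indicator_def intro!: ennreal_leI powr_mono2)
  finally have le: "ennreal (c powr q * V) \<le> I" .
  show ?thesis
  proof (cases "I = \<infinity>")
    case True
    then show ?thesis using False by (simp add: Lp_norm_def I_def q_def Let_def)
  next
    case False
    then obtain J where J: "I = ennreal J" "0 \<le> J" by (cases I) auto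
    have "c * V powr (1 / q) = (c powr q * V) powr (1 / q)"
      using c V q by (simp add: powr_mult powr_powr)
    also have "\<dots> \<le> J powr (1 / q)"
      using le J V q by (intro powr_mono2) (auto simp: ennreal_le_iff)
    finally have "c * V powr (1 / q) \<le> J powr (1 / q)" .
    moreover have "real_of_ereal (1 / p) = 1 / q"
      by (simp add: pq one_ereal_def)
    ultimately show ?thesis
      using False \<open>p \<noteq> \<infinity>\<close> J pq
      by (auto simp: Lp_norm_def I_def[symmetric] Let_def intro!: ennreal_leI)
  qed
qed

lemma Lp_norm_indicator:
  assumes "A \<in> sets M" "emeasure M A = ennreal V" "0 < V" and p: "0 < (p::real)"
  shows "Lp_norm M (ereal p) (indicator A) = ennreal (V powr (1 / p))"
proof -
  have "(\<integral>\<^sup>+ x. ennreal (norm (indicator A x :: complex) powr p) \<partial>M) = (\<integral>\<^sup>+ x. indicator A x \<partial>M)"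
    using p by (intro nn_integral_cong) (auto simp: indicator_def)
  then show ?thesis using assms by (simp add: Lp_norm_def Let_def)
qed

lemma indicator_in_Lp_space:
  assumes "A \<in> sets M" "emeasure M A = ennreal V" "0 < V" and p: "0 < (p::real)"
  shows "indicator A \<in> Lp_space M (ereal p)"
  using assms by (simp add: Lp_space_def Lp_norm_indicator)

section \<open>Surface measure and T on indicators\<close>

lemma sets_sphere_measure:
  assumes "A \<in> sets borel" "A \<subseteq> sphere 0 1"
  shows "A \<in> sets (sphere_measure :: 'a::euclidean_space measure)"
proof -
  have "A \<in> sets (restrict_space borel (sphere 0 1))"
    using assms by (auto simp: sets_restrict_space)
  then show ?thesis by (simp add: sphere_measure_def)
qed

text \<open>The cone over the whole sphere is the punctured unit ball, which has finite
  volume.\<close>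

lemma finite_measure_sphere_measure:
  "finite_measure (sphere_measure :: 'a::euclidean_space measure)"
proof
  have "emeasure lborel {x \<in> ball 0 1 - {0 :: 'a}. x /\<^sub>R norm x \<in> sphere 0 1}
      \<le> emeasure lborel (ball (0::'a) 1)"
    by (intro emeasure_mono) auto
  also have "\<dots> < \<infinity>" using emeasure_lborel_ball_finite[of "0::'a" 1] by simp
  finally show "emeasure (sphere_measure :: 'a measure) (space sphere_measure) \<noteq> \<infinity>"
    by (simp add: emeasure_sphere_measure ennreal_mult_eq_top_iff)
qed

text \<open>The integrand is the indicator of a Borel subset of the sphere, which has finite
  measure. It is therefore integrable for every \<open>x\<close>, and the default value 0 of the
  Bochner integral never intervenes.\<close>

lemma bilinear_spherical_indicator:
  assumes A: "A \<in> sets borel" and B: "B \<in> sets borel"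
  shows "bilinear_spherical (indicator A) (indicator B) x =
    of_real (measure sphere_measure {y \<in> sphere 0 1. x - y \<in> A \<and> x + y \<in> B})"
proof -
  interpret finite_measure "sphere_measure :: 'a measure"
    by (rule finite_measure_sphere_measure)
  define S where "S = {y \<in> sphere 0 1. x - y \<in> A \<and> x + y \<in> B}"
  have "S = sphere 0 1 \<inter> ((\<lambda>y. x - y) -` A \<inter> space borel) \<inter> ((\<lambda>y. x + y) -` B \<inter> space borel)"
    by (auto simp: S_def)
  also have "\<dots> \<in> sets borel"
    using A B by (intro sets.Int measurable_sets[of _ borel borel]) auto
  finally have S: "S \<in> sets sphere_measure"
    by (rule sets_sphere_measure) (auto simp: S_def)
  have "bilinear_spherical (indicator A) (indicator B) x =
      (LINT y|sphere_measure. (of_real (indicator S y) :: complex))"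
    unfolding bilinear_spherical_def
    by (intro Bochner_Integration.integral_cong) (auto simp: S_def indicator_def)
  also have "\<dots> = of_real (LINT y|sphere_measure. indicator S y)"
    by (rule integral_complex_of_real)
  also have "\<dots> = of_real (measure sphere_measure S)"
    using S sets.sets_into_space[OF S] by (simp add: Int_absorb2)
  finally show ?thesis by (simp add: S_def)
qed

section \<open>Boxes adapted to a coordinate direction\<close>

text \<open>With \<open>h\<close> a multiple of \<open>r^2\<close> this is the box of Knapp's
  example; \<open>h\<close> stays free because a box of fixed height is used inside the cone over a
  cap. As a \<open>cbox\<close> it is Borel and has a known volume.\<close>

definition knapp_box :: "'n \<Rightarrow> real \<Rightarrow> real \<Rightarrow> real \<Rightarrow> (real ^ 'n) set" where
  "knapp_box k c r h =
     cbox (\<chi> i. if i = k then c - h else - r) (\<chi> i. if i = k then c + h else r)"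

lemma mem_knapp_box:
  "x \<in> knapp_box k c r h \<longleftrightarrow> (\<forall>i. i \<noteq> k \<longrightarrow> \<bar>x $ i\<bar> \<le> r) \<and> \<bar>x $ k - c\<bar> \<le> h"
proof -
  have "x \<in> knapp_box k c r h \<longleftrightarrow>
      (\<forall>i. (if i = k then c - h else - r) \<le> x $ i \<and> x $ i \<le> (if i = k then c + h else r))"
    by (simp add: knapp_box_def mem_box_cart)
  also have "\<dots> \<longleftrightarrow> (\<forall>i. i \<noteq> k \<longrightarrow> \<bar>x $ i\<bar> \<le> r) \<and> \<bar>x $ k - c\<bar> \<le> h"
  proof -
    have "(if i = k then c - h else - r) \<le> x $ i \<and> x $ i \<le> (if i = k then c + h else r) \<longleftrightarrow>
        (if i = k then \<bar>x $ k - c\<bar> \<le> h else \<bar>x $ i\<bar> \<le> r)" for i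
      by auto
    then show ?thesis by metis
  qed
  finally show ?thesis .
qed

lemma sets_knapp_box [measurable]: "knapp_box k c r h \<in> sets borel"
  by (simp add: knapp_box_def)

lemma emeasure_knapp_box:
  fixes k :: "'n::finite"
  assumes "0 \<le> r" "0 \<le> h"
  shows "emeasure lborel (knapp_box k c r h) = ennreal ((2 * r) ^ (CARD('n) - 1) * (2 * h))"
proof -
  have ne: "cbox (\<chi> i. if i = k then c - h else - r) (\<chi> i. if i = k then c + h else r) \<noteq> {}"
    using assms by (auto simp: interval_ne_empty_cart)
  have "measure lborel (knapp_box k c r h) =
      (\<Prod>i\<in>UNIV. (if i = k then c + h else r) - (if i = k then c - h else - r))"
    unfolding knapp_box_def using content_cbox_cart[OF ne] by simp
  also have "\<dots> = 2 * h * (\<Prod>i\<in>UNIV - {k}. (2 * r))"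
    by (subst prod.remove[of UNIV k]) (auto intro!: prod.cong)
  also have "\<dots> = (2 * r) ^ (CARD('n) - 1) * (2 * h)"
    by (simp add: card_Diff_singleton)
  finally show ?thesis
    unfolding knapp_box_def
    by (subst emeasure_eq_ennreal_measure) (auto simp: emeasure_lborel_cbox_eq)
qed

text \<open>The distinguished direction is the last coordinate \<open>e m\<close>, so the conditions
  with \<open>r\<close> involve only the first block and the condition with \<open>h\<close> only
  the second. The splitting d = (d-1) + 1 is the one tested in the theorem.\<close>

lemma product_form_knapp_box:
  fixes e :: "nat \<Rightarrow> 'n::finite"
  assumes e: "bij_betw e {..<Suc m} UNIV"
  shows "product_form e m 1 (indicator (knapp_box (e m) c r h))"
proof -
  define f1 where "f1 v = (if \<forall>i<m. \<bar>v i\<bar> \<le> r then 1 else 0 :: complex)" for v :: "nat \<Rightarrow> real"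
  \<comment> \<open>Blocks are renumbered from 0, so \<open>v 0\<close> is the coordinate
    \<open>e m\<close>.\<close>
  define f2 where "f2 v = (if \<bar>v 0 - c\<bar> \<le> h then 1 else 0 :: complex)" for v :: "nat \<Rightarrow> real"
  have surj: "\<exists>j<m. i = e j" if "i \<noteq> e m" for i
  proof -
    have "i \<in> e ` {..<Suc m}" using e by (simp add: bij_betw_def)
    then show ?thesis using that by (auto simp: less_Suc_eq)
  qed
  have inj: "e j \<noteq> e m" if "j < m" for j
    using e that by (auto simp: bij_betw_def dest!: inj_onD)
  have "(\<forall>i. i \<noteq> e m \<longrightarrow> \<bar>x $ i\<bar> \<le> r) \<longleftrightarrow> (\<forall>j<m. \<bar>x $ e j\<bar> \<le> r)" for x :: "real ^ 'n"
    using surj inj by metis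
  then have "indicator (knapp_box (e m) c r h) x =
      f1 (coord_block e 0 m x) * f2 (coord_block e m 1 x)" for x
    by (auto simp: f1_def f2_def coord_block_def mem_knapp_box indicator_def)
  then show ?thesis unfolding product_form_def by blast
qed

section \<open>Height and measure of a spherical cap\<close>

text \<open>This is the curvature of the sphere: a cap of radius r stays within O(r^2) of its
  tangent plane. The other coordinates contribute at most d r^2 to 1 = |y|^2, and 1 - t is at most 1
  - t^2 for t in [0,1].\<close>

lemma one_minus_le_of_norm_eq_1:
  fixes y :: "real ^ 'n::finite"
  assumes y: "norm y = 1" "0 \<le> y $ k" and r: "\<And>i. i \<noteq> k \<Longrightarrow> \<bar>y $ i\<bar> \<le> r"
  shows "\<bar>y $ k - 1\<bar> \<le> real CARD('n) * r\<^sup>2"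
proof -
  have le1: "y $ k \<le> 1" using component_le_norm_cart[of y k] y by simp
  have "1 = (\<Sum>i\<in>UNIV. (y $ i)\<^sup>2)"
    using y(1) by (simp add: norm_vec_def L2_set_def)
  also have "\<dots> = (y $ k)\<^sup>2 + (\<Sum>i\<in>UNIV - {k}. (y $ i)\<^sup>2)"
    by (rule sum.remove) auto
  also have "(\<Sum>i\<in>UNIV - {k}. (y $ i)\<^sup>2) \<le> (\<Sum>i\<in>UNIV - {k}. r\<^sup>2)"
    using r by (intro sum_mono) (metis DiffD2 abs_ge_zero insertI1 power2_abs power_mono)
  also have "\<dots> \<le> real CARD('n) * r\<^sup>2"
    by (simp add: card_Diff_singleton mult_right_mono)
  finally have "1 - (y $ k)\<^sup>2 \<le> real CARD('n) * r\<^sup>2" by simp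
  moreover have "(y $ k)\<^sup>2 \<le> y $ k"
    using le1 y(2) by (simp add: power2_eq_square mult_left_le)
  ultimately show ?thesis using le1 by simp
qed

(* The cone over the cap contains the box of width about r around e_k/2. *)
lemma measure_cap_ge:
  fixes k :: "'n::finite"
  assumes r: "0 < r" "r \<le> 1 / real CARD('n)"
  shows "(r / 2) ^ (CARD('n) - 1) / 4 \<le>
    measure sphere_measure {y \<in> sphere 0 1. 0 \<le> y $ k \<and> (\<forall>i. i \<noteq> k \<longrightarrow> \<bar>y $ i\<bar> \<le> r)}"
    (is "_ \<le> measure _ ?K")
proof -
  interpret finite_measure "sphere_measure :: (real ^ 'n) measure"
    by (rule finite_measure_sphere_measure)
  have "?K = sphere 0 1 \<inter> {y. 0 \<le> y $ k} \<inter> (\<Inter>i\<in>UNIV - {k}. {y. \<bar>y $ i\<bar> \<le> r})"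
    by auto
  also have "closed \<dots>"
    by (intro closed_Int closed_INT ballI closed_Collect_le continuous_intros) auto
  finally have K: "?K \<in> sets borel" by (rule borel_closed)
  \<comment> \<open>These numbers put \<open>x $ k\<close> into [1/4, 1/2], away from the origin and
    well inside the ball. The volume of the box is
    \<open>(r / 2) ^ (CARD('n) - 1) * (1/4)\<close>.\<close>
  let ?Q = "knapp_box k (3/8) (r / 4) (1/8)"
  let ?R = "{x \<in> ball 0 1 - {0}. x /\<^sub>R norm x \<in> ?K}"
  have "?Q \<subseteq> ?R"
  proof
    fix x assume "x \<in> ?Q"
    then have x: "\<And>i. i \<noteq> k \<Longrightarrow> \<bar>x $ i\<bar> \<le> r / 4" and "\<bar>x $ k - 3/8\<bar> \<le> 1/8"
      by (auto simp: mem_knapp_box)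
    then have xk: "1/4 \<le> x $ k" "x $ k \<le> 1/2" by linarith+
    have nx: "1/4 \<le> norm x" using component_le_norm_cart[of x k] xk by linarith
    \<comment> \<open>The l^1 norm suffices: since r is at most 1/d, the transversal coordinates sum
      to at most 1/4, so \<open>norm x\<close> is at most 3/4.\<close>
    have "norm x \<le> (\<Sum>i\<in>UNIV. \<bar>x $ i\<bar>)" by (rule norm_le_l1_cart)
    also have "\<dots> = \<bar>x $ k\<bar> + (\<Sum>i\<in>UNIV - {k}. \<bar>x $ i\<bar>)"
      by (rule sum.remove) auto
    also have "(\<Sum>i\<in>UNIV - {k}. \<bar>x $ i\<bar>) \<le> (\<Sum>i\<in>UNIV - {k}. r / 4)"
      using x by (intro sum_mono) auto
    also have "\<dots> \<le> real CARD('n) * (r / 4)"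
      unfolding sum_constant using r by (intro mult_right_mono) (auto simp: card_Diff_singleton)
    also have "\<dots> \<le> 1/4" using r by (simp add: field_simps)
    finally have n1: "norm x < 1" using xk by linarith
    \<comment> \<open>Projection to the sphere divides by \<open>norm x\<close>, which is at least
      1/4; this is why the box has half-width r/4.\<close>
    have "\<bar>x $ i\<bar> \<le> r * norm x" if "i \<noteq> k" for i
      using x[OF that] mult_left_mono[OF nx, of r] r by linarith
    then show "x \<in> ?R"
      using nx n1 xk by (auto simp: abs_mult divide_simps mult.commute)
  qed
  moreover have "?R \<in> sets borel"
  proof -
    have "(\<lambda>x::real ^ 'n. x /\<^sub>R norm x) -` ?K \<inter> space borel \<in> sets borel"
      using K by (intro measurable_sets[of _ borel borel]) auto
    moreover have "?R = (ball 0 1 - {0}) \<inter> ((\<lambda>x. x /\<^sub>R norm x) -` ?K \<inter> space borel)"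
      by auto
    ultimately show ?thesis by (simp only:) (intro sets.Int, auto)
  qed
  ultimately have "emeasure lborel ?Q \<le> emeasure lborel ?R"
    by (intro emeasure_mono) auto
  \<comment> \<open>The factor d of the cone formula is at least 1.\<close>
  also have "\<dots> \<le> of_nat DIM(real ^ 'n) * emeasure lborel ?R"
  proof -
    have "(1::ennreal) \<le> of_nat DIM(real ^ 'n)" by (simp add: Suc_leI)
    from mult_right_mono[OF this, of "emeasure lborel ?R"] show ?thesis by (simp only: mult_1 zero_le)
  qed
  also have "\<dots> = emeasure sphere_measure ?K"
    by (subst emeasure_sphere_measure[OF K]) (auto simp only: mem_Collect_eq subset_iff)
  finally have "ennreal ((r / 2) ^ (CARD('n) - 1) * (1/4)) \<le> ennreal (measure sphere_measure ?K)"
    using r by (simp add: emeasure_knapp_box emeasure_eq_measure)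
  then show ?thesis by (simp add: ennreal_le_iff)
qed

section \<open>Comparison of powers near 0\<close>

text \<open>If b > a, division by r^a gives c \<le> K r^(b-a), whose right side tends to 0 as r ->
  0+, against c > 0.\<close>

lemma powr_exponent_le:
  fixes a b K :: real
  assumes c: "0 < c" and s: "0 < s"
    and le: "\<And>r. 0 < r \<Longrightarrow> r \<le> s \<Longrightarrow> c * r powr a \<le> K * r powr b"
  shows "b \<le> a"
proof (rule ccontr)
  assume "\<not> b \<le> a"
  then have "((\<lambda>r. K * r powr (b - a)) \<longlongrightarrow> K * 0) (at_right 0)"
    by (intro tendsto_mult_left tendsto_zero_powrI[of _ _ _ "b - a"] tendsto_ident_at tendsto_const)
       (auto simp: eventually_at_topological)
  moreover have "eventually (\<lambda>r. c \<le> K * r powr (b - a)) (at_right 0)"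
    using eventually_at_right_less[of "0::real"] eventually_at_right_real[OF s]
  proof eventually_elim
    case (elim r)
    then show ?case using le[of r] by (simp add: powr_diff field_simps)
  qed
  ultimately have "c \<le> K * 0" by (rule tendsto_lowerbound) auto
  with c show False by simp
qed

section \<open>Lower bound for T in Knapp's example\<close>

text \<open>Every \<open>y\<close> of the cap counts: \<open>x\<close> is as close to 0, and
  \<open>y\<close> to e_k, as the widths r and d r^2 allow, so by the triangle inequality x - y and
  x + y lie in the boxes of twice these widths around -e_k and e_k. \<open>measure_cap_ge\<close>
  then applies.\<close>

lemma bilinear_spherical_knapp_ge:
  fixes k :: "'n::finite"
  assumes r: "0 < r" "r \<le> 1 / real CARD('n)"
    and x: "x \<in> knapp_box k 0 r (real CARD('n) * r\<^sup>2)"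
  shows "(r / 2) ^ (CARD('n) - 1) / 4 \<le> norm (bilinear_spherical
    (indicator (knapp_box k (-1) (2 * r) (2 * real CARD('n) * r\<^sup>2)))
    (indicator (knapp_box k 1 (2 * r) (2 * real CARD('n) * r\<^sup>2))) x)"
proof -
  interpret finite_measure "sphere_measure :: (real ^ 'n) measure"
    by (rule finite_measure_sphere_measure)
  let ?h = "real CARD('n) * r\<^sup>2"
  let ?A = "knapp_box k (-1) (2 * r) (2 * ?h)" and ?B = "knapp_box k 1 (2 * r) (2 * ?h)"
  let ?K = "{y \<in> sphere 0 1. 0 \<le> y $ k \<and> (\<forall>i. i \<noteq> k \<longrightarrow> \<bar>y $ i\<bar> \<le> r)}"
  let ?S = "{y \<in> sphere 0 1. x - y \<in> ?A \<and> x + y \<in> ?B}"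
  have "?K \<subseteq> ?S"
  proof
    fix y assume y: "y \<in> ?K"
    then have "\<bar>y $ k - 1\<bar> \<le> ?h" by (intro one_minus_le_of_norm_eq_1) auto
    moreover have "\<bar>x $ k\<bar> \<le> ?h" and "\<And>i. i \<noteq> k \<Longrightarrow> \<bar>x $ i\<bar> \<le> r"
      using x by (auto simp: mem_knapp_box)
    moreover have "\<And>i. i \<noteq> k \<Longrightarrow> \<bar>y $ i\<bar> \<le> r" using y by auto
    ultimately have "\<bar>x $ k - y $ k + 1\<bar> \<le> 2 * ?h" "\<bar>x $ k + y $ k - 1\<bar> \<le> 2 * ?h"
      "\<And>i. i \<noteq> k \<Longrightarrow> \<bar>x $ i - y $ i\<bar> \<le> 2 * r" "\<And>i. i \<noteq> k \<Longrightarrow> \<bar>x $ i + y $ i\<bar> \<le> 2 * r"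
      by (linarith, linarith, smt (verit), smt (verit))
    then show "y \<in> ?S" using y by (auto simp: mem_knapp_box)
  qed
  moreover have "?S \<in> sets sphere_measure"
  proof (rule sets_sphere_measure)
    have "?S = sphere 0 1 \<inter> ((\<lambda>y. x - y) -` ?A \<inter> space borel) \<inter> ((\<lambda>y. x + y) -` ?B \<inter> space borel)"
      by auto
    also have "\<dots> \<in> sets borel"
      by (intro sets.Int measurable_sets[of _ borel borel]) auto
    finally show "?S \<in> sets borel" .
  qed auto
  ultimately have "measure sphere_measure ?K \<le> measure sphere_measure ?S"
    by (rule finite_measure_mono)
  then show ?thesis
    using measure_cap_ge[OF r, of k]
    by (simp add: bilinear_spherical_indicator mult.assoc)
qed

section \<open>Testing the assumed bound as the box width tends to 0\<close>

theorem proposition5p1: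
  fixes e :: "nat \<Rightarrow> 'n::finite" and p1 p2 C :: real and p :: ereal
  assumes d: "CARD('n) \<ge> 2"
    and e: "bij_betw e {..<CARD('n)} UNIV"
    and p1: "1 \<le> p1" and p2: "1 \<le> p2" and p: "0 < p"
    and bound: "\<And>d1 d2 (f :: real ^ 'n \<Rightarrow> complex) (g :: real ^ 'n \<Rightarrow> complex).
      0 < d1 \<Longrightarrow> 0 < d2 \<Longrightarrow> CARD('n) = d1 + d2 \<Longrightarrow>
      f \<in> Lp_space lebesgue p1 \<Longrightarrow> g \<in> Lp_space lebesgue p2 \<Longrightarrow>
      product_form e d1 d2 f \<Longrightarrow> product_form e d1 d2 g \<Longrightarrow>
      Lp_norm lebesgue p (bilinear_spherical f g)
        \<le> ennreal C * Lp_norm lebesgue p1 f * Lp_norm lebesgue p2 g"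
  shows "ereal ((real CARD('n) + 1) / p1 + (real CARD('n) + 1) / p2)
    \<le> ereal (real CARD('n) - 1) + ereal (real CARD('n) + 1) / p"
proof -
  define n where "n = real CARD('n)"
  define m where "m = CARD('n) - 1"
  \<comment> \<open>The real number 1/p, equal to 0 when \<open>p = \<infinity>\<close>.\<close>
  define q where "q = real_of_ereal (1 / p)"
  \<comment> \<open>\<open>\<alpha>\<close> and \<open>\<beta>\<close> are the volumes, at r = 1, of
    the box for \<open>x\<close> and of the doubled boxes for f and g.\<close>
  define \<alpha> where "\<alpha> = 2 ^ m * (2 * n)"
  define \<beta> where "\<beta> = 4 ^ m * (4 * n)"
  have m: "0 < m" "CARD('n) = m + 1" "n = real m + 1" using d by (auto simp: m_def n_def)
  have pos: "0 < \<alpha>" "0 < \<beta>" using m by (auto simp: \<alpha>_def \<beta>_def)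
  have q: "ereal (n + 1) / p = ereal ((n + 1) * q)"
    using p by (cases p) (auto simp: q_def one_ereal_def)
  have vol: "emeasure lebesgue (knapp_box (e m) c r (n * r\<^sup>2)) = ennreal (\<alpha> * r powr (n + 1))"
    "emeasure lebesgue (knapp_box (e m) c (2 * r) (2 * n * r\<^sup>2)) = ennreal (\<beta> * r powr (n + 1))"
    if "0 < r" for c r
  proof -
    \<comment> \<open>The m = d-1 widths of order r and one of order r^2 produce the exponent
      d+1.\<close>
    have "r powr (n + 1) = r ^ m * r\<^sup>2"
      using that m powr_realpow[of r "m + 2"] by (simp add: power_add power2_eq_square add.commute)
    then show "emeasure lebesgue (knapp_box (e m) c r (n * r\<^sup>2)) = ennreal (\<alpha> * r powr (n + 1))"
      "emeasure lebesgue (knapp_box (e m) c (2 * r) (2 * n * r\<^sup>2)) = ennreal (\<beta> * r powr (n + 1))"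
      using that m
      by (simp_all add: emeasure_knapp_box m_def[symmetric] \<alpha>_def \<beta>_def power_mult_distrib mult_ac)
  qed
  \<comment> \<open>The left constant collects the cap and \<open>?X\<close>, the right one
    \<open>C\<close> and the norms of the two indicators; the range r \<le> 1/n is the one required
    by the cap estimate.\<close>
  have "(n + 1) * (1 / p1 + 1 / p2) \<le> (n - 1) + (n + 1) * q"
  proof (rule powr_exponent_le[of "(1 / 2) ^ m / 4 * \<alpha> powr q" "1 / n"
        _ "max C 0 * \<beta> powr (1 / p1) * \<beta> powr (1 / p2)"])
    fix r :: real assume r: "0 < r" "r \<le> 1 / n"
    define V where "V = \<beta> * r powr (n + 1)"
    have V: "0 < V" using r pos by (simp add: V_def)
    let ?A = "knapp_box (e m) (-1) (2 * r) (2 * n * r\<^sup>2)"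
    let ?B = "knapp_box (e m) 1 (2 * r) (2 * n * r\<^sup>2)"
    let ?X = "knapp_box (e m) 0 r (n * r\<^sup>2)"
    have sets: "?A \<in> sets lebesgue" "?B \<in> sets lebesgue" "?X \<in> sets lebesgue"
      by (auto intro!: sets_completionI_sets)
    note vol_A = vol(2)[OF r(1), of "-1", folded V_def]
    note vol_B = vol(2)[OF r(1), of 1, folded V_def]
    have pf: "product_form e m 1 (indicator (knapp_box (e m) c \<rho> h))" for c \<rho> h
      using e m by (intro product_form_knapp_box) simp
    have "ennreal ((r / 2) ^ m / 4 * (\<alpha> * r powr (n + 1)) powr real_of_ereal (1 / p))
        \<le> Lp_norm lebesgue p (bilinear_spherical (indicator ?A) (indicator ?B))"
      using r pos p bilinear_spherical_knapp_ge[of r _ "e m"]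
      by (intro Lp_norm_ge[OF sets(3) vol(1)]) (auto simp: n_def m_def)
    \<comment> \<open>The assumed bound with d1 = m and d2 = 1; m is positive because d is at least
      2.\<close>
    also have "\<dots> \<le> ennreal C * Lp_norm lebesgue p1 (indicator ?A) * Lp_norm lebesgue p2 (indicator ?B)"
      using m p1 p2 sets V vol_A vol_B
      by (intro bound[of m 1] pf indicator_in_Lp_space) auto
    \<comment> \<open>\<open>ennreal\<close> sends a negative \<open>C\<close> to 0, hence
      \<open>max C 0\<close> once the inequality is read in the reals.\<close>
    also have "\<dots> = ennreal (max C 0) * ennreal (V powr (1 / p1)) * ennreal (V powr (1 / p2))"
      using p1 p2 V Lp_norm_indicator[OF sets(1) vol_A] Lp_norm_indicator[OF sets(2) vol_B]
      by (simp add: max_def ennreal_neg)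
    also have "\<dots> = ennreal (max C 0 * V powr (1 / p1) * V powr (1 / p2))"
      by (simp add: ennreal_mult)
    finally have "(r / 2) ^ m / 4 * (\<alpha> * r powr (n + 1)) powr q
        \<le> max C 0 * V powr (1 / p1) * V powr (1 / p2)"
      by (simp add: ennreal_le_iff q_def)
    moreover have "(r / 2) ^ m / 4 * (\<alpha> * r powr (n + 1)) powr q =
        (1 / 2) ^ m / 4 * \<alpha> powr q * r powr (n - 1 + (n + 1) * q)"
    proof -
      have "r ^ m = r powr (n - 1)" using r m by (simp add: powr_realpow)
      moreover have "(\<alpha> * r powr (n + 1)) powr q = \<alpha> powr q * r powr ((n + 1) * q)"
        using r pos by (simp add: powr_mult powr_powr)
      ultimately show ?thesis by (simp only: power_divide power_one powr_add) simp
    qed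
    moreover have "max C 0 * V powr (1 / p1) * V powr (1 / p2) =
        max C 0 * \<beta> powr (1 / p1) * \<beta> powr (1 / p2) * r powr ((n + 1) * (1 / p1 + 1 / p2))"
    proof -
      have "V powr (1 / s) = \<beta> powr (1 / s) * r powr ((n + 1) * (1 / s))" for s
        using r pos by (simp add: V_def powr_mult powr_powr)
      then show ?thesis
        by (simp only: distrib_left[of "n + 1"] powr_add mult_ac)
    qed
    ultimately show "(1 / 2) ^ m / 4 * \<alpha> powr q * r powr (n - 1 + (n + 1) * q)
        \<le> max C 0 * \<beta> powr (1 / p1) * \<beta> powr (1 / p2) * r powr ((n + 1) * (1 / p1 + 1 / p2))"
      by simp
  qed (use pos m in auto)
  then show ?thesis
    by (simp add: q n_def[symmetric] distrib_left)
qed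

end
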